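(* Let $f:X\to Y$ be a retraction map with $f':X'\to Y'$ (as defined in the context). Then $\operatorname{cat}(f')\le\operatorname{cat}(f)$.
   Context: All maps are continuous and all spaces are normal topological spaces. Retraction map: let $f:X\to Y$ be a map, $X'\subseteq X$ and $Y'\subseteq Y$ subspaces, with $f(X')\subseteq Y'$, and let $f':=f|_{X'}:X'\to Y'$. One says that $f:X\to Y$ is a retraction map with $f':X'\to Y'$ if there are retractions $r_X:X\to X'$ and $r_Y:Y\to Y'$ (continuous maps with $r_X|_{X'}=\mathrm{id}_{X'}$ and $r_Y|_{Y'}=\mathrm{id}_{Y'}$) such that $r_Y\circ f=f'\circ r_X$. Lusternik-Schnirelmann category of a map: for a map $f:X\to Y$, $\operatorname{cat}(f)$ is the minimal number $n$ such that $X$ admits an open cover by $n+1$ open sets $U_0,U_1,\dots,U_n$ such that the restriction $f|_{U_i}:U_i\to Y$ is null-homotopic for each $i$ (and $\operatorname{cat}(f)=\infty$ if no such $n$ exists). *)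

theory Defs
  imports "HOL-Analysis.Analysis" "HOL-Library.Extended_Nat"
begin

text \<open>
  A map between two spaces is a HOL function that is only meaningful on the topspace of its
  domain; all notions below are insensitive to its values elsewhere.
\<close>

definition null_homotopic_map :: "'a topology \<Rightarrow> 'b topology \<Rightarrow> ('a \<Rightarrow> 'b) \<Rightarrow> bool" where
  "null_homotopic_map X Y f \<longleftrightarrow> (\<exists>c. homotopic_with (\<lambda>_. True) X Y f (\<lambda>_. c))"
  \<comment> \<open>As soon as X is nonempty, c necessarily belongs to topspace Y.\<close>

text \<open>
  The sets of a cover are indexed by 0, ..., n and may be empty or repeated. The infimum of
  the empty set in enat is infinity.
\<close>

definition cat_map :: "'a topology \<Rightarrow> 'b topology \<Rightarrow> ('a \<Rightarrow> 'b) \<Rightarrow> enat" where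
  "cat_map X Y f = Inf {enat n | n. \<exists>U :: nat \<Rightarrow> 'a set.
      (\<forall>i\<le>n. openin X (U i) \<and> null_homotopic_map (subtopology X (U i)) Y f) \<and>
      (\<Union>i\<le>n. U i) = topspace X}"

text \<open>
  The map f from X to Y is a retraction map with f' from X' to Y', where X' and Y' carry
  the subspace topologies and f' is the restriction of f. This is unrelated to
  the constant retraction_map of HOL-Analysis, which says that a single map has a
  continuous right inverse.
\<close>

definition retraction_map_with ::
  "'a topology \<Rightarrow> 'b topology \<Rightarrow> ('a \<Rightarrow> 'b) \<Rightarrow> 'a set \<Rightarrow> 'b set \<Rightarrow> ('a \<Rightarrow> 'b) \<Rightarrow> bool" where
  "retraction_map_with X Y f X' Y' f' \<longleftrightarrow>
     continuous_map X Y f \<and>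
     X' \<subseteq> topspace X \<and> Y' \<subseteq> topspace Y \<and> f ` X' \<subseteq> Y' \<and>
     (\<forall>x\<in>X'. f' x = f x) \<and>
     (\<exists>rX rY.
        continuous_map X (subtopology X X') rX \<and> (\<forall>x\<in>X'. rX x = x) \<and>
        continuous_map Y (subtopology Y Y') rY \<and> (\<forall>y\<in>Y'. rY y = y) \<and>
        (\<forall>x\<in>topspace X. rY (f x) = f' (rX x)))"

end

theory Submission
  imports Defs
begin

text \<open>
  The restriction \<open>f'\<close> factors through \<open>f\<close>: since \<open>r\<^sub>Y\<close> fixes \<open>Y'\<close> and \<open>f\<close> maps \<open>X'\<close> into \<open>Y'\<close>,
  it agrees on \<open>X'\<close> with the composite of the inclusion of \<open>X'\<close> into \<open>X\<close>, the map \<open>f\<close>, and the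
  retraction \<open>r\<^sub>Y\<close>. The category of a map cannot grow under composition on either side.
  Composing on the left keeps the cover and pushes each null-homotopy forward
  (\<open>cat_map_compose_left\<close>); composing on the right pulls the cover back and restricts each
  null-homotopy along the inner map (\<open>cat_map_compose_right\<close>). Applying both inequalities to this
  factorisation gives the theorem.
\<close>

lemma null_homotopic_map_cong:
  assumes "null_homotopic_map X Y f" and "\<And>x. x \<in> topspace X \<Longrightarrow> g x = f x"
  shows "null_homotopic_map X Y g"
  using assms unfolding null_homotopic_map_def by (blast intro: homotopic_with_eq)

lemma null_homotopic_map_compose_left:
  assumes "null_homotopic_map X Y f" and "continuous_map Y Z g"
  shows "null_homotopic_map X Z (g \<circ> f)"
proof -
  obtain c where "homotopic_with (\<lambda>_. True) X Y f (\<lambda>_. c)"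
    using assms(1) unfolding null_homotopic_map_def by blast
  then have "homotopic_with (\<lambda>_. True) X Z (g \<circ> f) (g \<circ> (\<lambda>_. c))"
    using assms(2) by (rule homotopic_with_compose_continuous_map_left) simp
  then show ?thesis
    unfolding null_homotopic_map_def o_def by blast
qed

lemma null_homotopic_map_compose_right:
  assumes "null_homotopic_map X Y f" and "continuous_map W X h"
  shows "null_homotopic_map W Y (f \<circ> h)"
proof -
  obtain c where "homotopic_with (\<lambda>_. True) X Y f (\<lambda>_. c)"
    using assms(1) unfolding null_homotopic_map_def by blast
  then have "homotopic_with (\<lambda>_. True) W Y (f \<circ> h) ((\<lambda>_. c) \<circ> h)"
    using assms(2) by (rule homotopic_with_compose_continuous_map_right) simp
  then show ?thesis
    unfolding null_homotopic_map_def o_def by blast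
qed

text \<open>
  Two categories, possibly of maps with different domains, are compared by transforming the
  covers admissible for one map into equally long covers admissible for the other.
\<close>
lemma cat_map_mono:
  assumes "\<And>(n::nat) U. \<lbrakk>\<And>i. i \<le> n \<Longrightarrow> openin X (U i);
      \<And>i. i \<le> n \<Longrightarrow> null_homotopic_map (subtopology X (U i)) Y f;
      (\<Union>i\<le>n. U i) = topspace X\<rbrakk>
    \<Longrightarrow> \<exists>V. (\<forall>i\<le>n. openin W (V i) \<and> null_homotopic_map (subtopology W (V i)) Z g) \<and>
          (\<Union>i\<le>n. V i) = topspace W"
  shows "cat_map W Z g \<le> cat_map X Y f"
  unfolding cat_map_def
proof (rule Inf_superset_mono, rule subsetI, elim CollectE exE conjE)
  fix k n U
  assume "k = enat n"
    and U: "\<forall>i\<le>n. openin X (U i) \<and> null_homotopic_map (subtopology X (U i)) Y f"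
      "(\<Union>i\<le>n. U i) = topspace X"
  moreover have "\<exists>V. (\<forall>i\<le>n. openin W (V i) \<and> null_homotopic_map (subtopology W (V i)) Z g) \<and>
      (\<Union>i\<le>n. V i) = topspace W"
    by (rule assms[where U = U]) (use U in simp_all)
  ultimately show "k \<in> {enat n | n. \<exists>V. (\<forall>i\<le>n. openin W (V i) \<and>
      null_homotopic_map (subtopology W (V i)) Z g) \<and> (\<Union>i\<le>n. V i) = topspace W}"
    by (intro CollectI exI[of _ n] conjI)
qed

lemma cat_map_cong:
  assumes "\<And>x. x \<in> topspace X \<Longrightarrow> f x = g x"
  shows "cat_map X Y f = cat_map X Y g"
proof -
  have "null_homotopic_map (subtopology X V) Y f
      \<longleftrightarrow> null_homotopic_map (subtopology X V) Y g" for V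
    by (auto elim!: null_homotopic_map_cong simp: assms)
  then show ?thesis
    unfolding cat_map_def by simp
qed

lemma cat_map_compose_left:
  assumes "continuous_map Y Z g"
  shows "cat_map X Z (g \<circ> f) \<le> cat_map X Y f"
proof (rule cat_map_mono)
  fix n and U :: "nat \<Rightarrow> _ set"
  assume "\<And>i. i \<le> n \<Longrightarrow> openin X (U i)"
    and "\<And>i. i \<le> n \<Longrightarrow> null_homotopic_map (subtopology X (U i)) Y f"
    and "(\<Union>i\<le>n. U i) = topspace X"
  then show "\<exists>V. (\<forall>i\<le>n. openin X (V i) \<and>
      null_homotopic_map (subtopology X (V i)) Z (g \<circ> f)) \<and> (\<Union>i\<le>n. V i) = topspace X"
    using assms by (intro exI[of _ U] conjI allI impI null_homotopic_map_compose_left)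
qed

text \<open>
  The preimages under \<open>h\<close> of an admissible open cover for \<open>f\<close> form one for \<open>f \<circ> h\<close>, because \<open>h\<close>
  restricts to a map from each preimage to the corresponding member of the cover.
\<close>
lemma cat_map_compose_right:
  assumes h: "continuous_map W X h"
  shows "cat_map W Y (f \<circ> h) \<le> cat_map X Y f"
proof (rule cat_map_mono)
  fix n and U :: "nat \<Rightarrow> _ set"
  assume op: "\<And>i. i \<le> n \<Longrightarrow> openin X (U i)"
    and null: "\<And>i. i \<le> n \<Longrightarrow> null_homotopic_map (subtopology X (U i)) Y f"
    and cover: "(\<Union>i\<le>n. U i) = topspace X"
  define V where "V i = {w \<in> topspace W. h w \<in> U i}" for i
  have "openin W (V i)" if "i \<le> n" for i
    unfolding V_def using h op[OF that] by (rule openin_continuous_map_preimage)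
  moreover have "null_homotopic_map (subtopology W (V i)) Y (f \<circ> h)" if "i \<le> n" for i
  proof -
    have "continuous_map (subtopology W (V i)) (subtopology X (U i)) h"
      using h by (auto simp: V_def continuous_map_in_subtopology continuous_map_from_subtopology)
    then show ?thesis
      by (rule null_homotopic_map_compose_right[OF null[OF that]])
  qed
  moreover have "(\<Union>i\<le>n. V i) = topspace W"
    using continuous_map_image_subset_topspace[OF h] cover unfolding V_def by blast
  ultimately show "\<exists>V. (\<forall>i\<le>n. openin W (V i) \<and>
      null_homotopic_map (subtopology W (V i)) Y (f \<circ> h)) \<and> (\<Union>i\<le>n. V i) = topspace W"
    by blast
qed

theorem theorem4p4:
  fixes X :: "'a topology" and Y :: "'b topology"
    and f f' :: "'a \<Rightarrow> 'b"
    and X' :: "'a set" and Y' :: "'b set"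
  assumes "normal_space X" and "normal_space Y"
    and "normal_space (subtopology X X')" and "normal_space (subtopology Y Y')"
    and "retraction_map_with X Y f X' Y' f'"
  shows "cat_map (subtopology X X') (subtopology Y Y') f' \<le> cat_map X Y f"
proof -
  obtain rY where rY: "continuous_map Y (subtopology Y Y') rY" "\<And>y. y \<in> Y' \<Longrightarrow> rY y = y"
    and f: "f ` X' \<subseteq> Y'" "\<And>x. x \<in> X' \<Longrightarrow> f' x = f x"
    using assms(5) unfolding retraction_map_with_def by blast
  have "cat_map (subtopology X X') (subtopology Y Y') f'
      = cat_map (subtopology X X') (subtopology Y Y') ((rY \<circ> f) \<circ> id)"
    using rY(2) f by (intro cat_map_cong) (simp add: image_subset_iff)
  also have "\<dots> \<le> cat_map X (subtopology Y Y') (rY \<circ> f)"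
    by (intro cat_map_compose_right continuous_map_id_subt)
  also have "\<dots> \<le> cat_map X Y f"
    using rY(1) by (rule cat_map_compose_left)
  finally show ?thesis .
qed

end
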